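(* Suppose $G$ and $H$ are good graphs. Then $\gamma(G\square H)=\gamma(G)\gamma(H)$ if and only if $G\square H$ is good.
   Context: All graphs are finite and connected. A pebbling step removes two pebbles from a vertex and places one pebble on an adjacent vertex. The cover pebbling number $\gamma(G)$ is the minimum $N$ such that for every placement of $N$ pebbles on $G$ some sequence of pebbling steps leaves at least one pebble on every vertex. A graph $G$ is good if $\gamma(G)=\sum_{w\in V(G)}2^{\mathrm{dist}(w,u)}$ for some vertex $u\in V(G)$. $G\square H$ is the Cartesian product: vertex set $V(G)\times V(H)$, with $(w,v)\sim(w',v')$ iff ($w=w'$ and $v\sim v'$) or ($v=v'$ and $w\sim w'$). *)

theory Defs
  imports "Graph_Theory.Digraph_Component" "HOL-Library.Multiset"
begin

text \<open>
  Simple graphs are rendered by \<^locale>\<open>pair_graph\<close>: each edge is a pair of opposite arcs.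
  Note that \<^const>\<open>connected\<close> excludes the empty graph.
\<close>

text \<open>Only meaningful when some walk from \<open>u\<close> to \<open>v\<close> exists.\<close>

definition gdist :: "'a pair_pre_digraph \<Rightarrow> 'a \<Rightarrow> 'a \<Rightarrow> nat" where
  "gdist G u v = (LEAST n. \<exists>p. pre_digraph.awalk (with_proj G) u p v \<and> length p = n)"

text \<open>
  A placement of pebbles is a multiset of vertices; the multiplicity of a vertex is the
  number of pebbles on it.
\<close>

definition placement :: "'a pair_pre_digraph \<Rightarrow> nat \<Rightarrow> 'a multiset \<Rightarrow> bool" where
  "placement G N M \<longleftrightarrow> set_mset M \<subseteq> pverts G \<and> size M = N"

definition pebbling_step :: "'a pair_pre_digraph \<Rightarrow> 'a multiset \<Rightarrow> 'a multiset \<Rightarrow> bool" where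
  "pebbling_step G M M' \<longleftrightarrow>
     (\<exists>u v. (u, v) \<in> parcs G \<and> {#u, u#} \<subseteq># M \<and> M' = M - {#u, u#} + {#v#})"

definition cover_solvable :: "'a pair_pre_digraph \<Rightarrow> 'a multiset \<Rightarrow> bool" where
  "cover_solvable G M \<longleftrightarrow> (\<exists>M'. (pebbling_step G)\<^sup>*\<^sup>* M M' \<and> (\<forall>v\<in>pverts G. 1 \<le> count M' v))"

definition cover_pebbling_number :: "'a pair_pre_digraph \<Rightarrow> nat" where
  "cover_pebbling_number G = (LEAST N. \<forall>M. placement G N M \<longrightarrow> cover_solvable G M)"

definition good :: "'a pair_pre_digraph \<Rightarrow> bool" where
  "good G \<longleftrightarrow> (\<exists>u\<in>pverts G. cover_pebbling_number G = (\<Sum>w\<in>pverts G. 2 ^ gdist G w u))"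

definition cartesian_product ::
  "'a pair_pre_digraph \<Rightarrow> 'b pair_pre_digraph \<Rightarrow> ('a \<times> 'b) pair_pre_digraph" where
  "cartesian_product G H =
     \<lparr> pverts = pverts G \<times> pverts H,
       parcs = {((w, v), (w', v')) | w v w' v'.
         (w = w' \<and> w \<in> pverts G \<and> (v, v') \<in> parcs H) \<or>
         (v = v' \<and> v \<in> pverts H \<and> (w, w') \<in> parcs G)} \<rparr>"

end

theory Submission
  imports Defs
begin

text \<open>
  Stacking all pebbles on one vertex \<open>u\<close> shows that the cover pebbling number is at least
  \<open>s(u)\<close>, the sum of \<open>2 ^ dist(w, u)\<close> over all \<open>w\<close>: weighting a pebble on \<open>w\<close> by \<open>2 ^ dist(w, u)\<close>,
  no pebbling step increases the total weight. Hence a graph is good iff its cover pebbling number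
  is the maximum of \<open>s\<close>. Distances in a Cartesian product add up, so \<open>s\<close> is multiplicative, and
  so is its maximum.
\<close>

definition stacking_number :: "'a pair_pre_digraph \<Rightarrow> 'a \<Rightarrow> nat" where
  "stacking_number G u = (\<Sum>w\<in>pverts G. 2 ^ gdist G w u)"

section \<open>Connectivity and distance through relational powers of the arc relation\<close>

locale connected_pair_graph = pair_pseudo_graph G for G :: "'a pair_pre_digraph" +
  assumes verts_connected: "\<lbrakk>u \<in> pverts G; v \<in> pverts G\<rbrakk> \<Longrightarrow> (u, v) \<in> (parcs G)\<^sup>*"

lemma connected_pair_graphI:
  assumes "pair_graph G" and "Digraph_Component.connected (with_proj G)"
  shows "connected_pair_graph G"
proof -
  interpret pair_graph G by fact
  show ?thesis
  proof
    fix u v assume "u \<in> pverts G" "v \<in> pverts G"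
    moreover have "strongly_connected (with_proj G)"
      using pair_sym_arcs assms(2) by (rule symmetric_connected_imp_strongly_connected)
    ultimately have "u \<rightarrow>\<^sup>*\<^bsub>with_proj G\<^esub> v"
      by (simp add: strongly_connected_def)
    then show "(u, v) \<in> (parcs G)\<^sup>*"
      by (metis reachable_rtranclI with_proj_simps(3))
  qed
qed

text \<open>Trades walks as arc lists for powers of a relation, so that distances, pebble transport
  and products can all be treated by induction on an exponent. At \<open>n = 0\<close> the empty
  walk requires \<open>u\<close> to be a vertex, whereas the zeroth power is the identity on the
  whole type.\<close>

lemma (in pair_wf_digraph) ex_awalk_length_iff_relpow:
  assumes "u \<in> pverts G"
  shows "(\<exists>p. awalk u p v \<and> length p = n) \<longleftrightarrow> (u, v) \<in> parcs G ^^ n"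
  using assms
proof (induction n arbitrary: u)
  case 0
  then show ?case by (auto simp: awalk_Nil_iff)
next
  case (Suc n)
  have "(\<exists>p. awalk u p v \<and> length p = Suc n)
      \<longleftrightarrow> (\<exists>w. (u, w) \<in> parcs G \<and> (\<exists>p. awalk w p v \<and> length p = n))"
    (is "?L \<longleftrightarrow> ?R")
  proof
    assume ?L
    then obtain e p where "awalk u (e # p) v" "length p = n"
      by (auto simp: length_Suc_conv)
    then show ?R
      by (intro exI[of _ "snd e"]) (auto simp: awalk_Cons_iff)
  next
    assume ?R
    then obtain w p where "(u, w) \<in> parcs G" "awalk w p v" "length p = n" by blast
    then show ?L
      by (intro exI[of _ "(u, w) # p"]) (simp add: awalk_Cons_iff)
  qed
  also have "\<dots> \<longleftrightarrow> (\<exists>w. (u, w) \<in> parcs G \<and> (w, v) \<in> parcs G ^^ n)"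
    using Suc.IH in_arcsD2 by blast
  also have "\<dots> \<longleftrightarrow> (u, v) \<in> parcs G ^^ Suc n"
    by (meson relpow_Suc_D2 relpow_Suc_I2)
  finally show ?case .
qed

lemma (in pair_wf_digraph) gdist_eq_Least_relpow:
  "u \<in> pverts G \<Longrightarrow> gdist G u v = (LEAST n. (u, v) \<in> parcs G ^^ n)"
  by (simp add: gdist_def ex_awalk_length_iff_relpow)

lemma (in pair_wf_digraph) gdist_le:
  "\<lbrakk>u \<in> pverts G; (u, v) \<in> parcs G ^^ n\<rbrakk> \<Longrightarrow> gdist G u v \<le> n"
  by (simp add: gdist_eq_Least_relpow Least_le)

section \<open>Combining pebbling sequences and transporting a pebble along a walk\<close>

lemma pebbling_step_add:
  "pebbling_step G M M' \<Longrightarrow> pebbling_step G (M + K) (M' + K)"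
proof -
  assume "pebbling_step G M M'"
  then obtain u v where uv: "(u, v) \<in> parcs G" "{#u, u#} \<subseteq># M" "M' = M - {#u, u#} + {#v#}"
    unfolding pebbling_step_def by blast
  then have "{#u, u#} \<subseteq># M + K" "M' + K = M + K - {#u, u#} + {#v#}"
    by (auto simp: subset_mset.add_increasing2 simp flip: subset_mset.diff_add_assoc2)
  then show ?thesis
    unfolding pebbling_step_def using uv(1) by blast
qed

lemma pebbling_steps_add:
  "(pebbling_step G)\<^sup>*\<^sup>* M M' \<Longrightarrow> (pebbling_step G)\<^sup>*\<^sup>* (M + K) (M' + K)"
  by (induction rule: rtranclp_induct) (auto intro: rtranclp.rtrancl_into_rtrancl pebbling_step_add)

text \<open>First the pebbles of \<open>M\<close> move while \<open>K\<close> lies idle, then those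
  of \<open>K\<close> move while \<open>M'\<close> lies idle.\<close>

lemma pebbling_steps_add_add:
  assumes "(pebbling_step G)\<^sup>*\<^sup>* M M'" and "(pebbling_step G)\<^sup>*\<^sup>* K K'"
  shows "(pebbling_step G)\<^sup>*\<^sup>* (M + K) (M' + K')"
  using pebbling_steps_add[OF assms(1), of K] pebbling_steps_add[OF assms(2), of M']
  by (simp add: add.commute)

lemma pebbling_steps_sum:
  assumes "finite A" and "\<And>x. x \<in> A \<Longrightarrow> (pebbling_step G)\<^sup>*\<^sup>* (f x) (g x)"
  shows "(pebbling_step G)\<^sup>*\<^sup>* (\<Sum>x\<in>A. f x) (\<Sum>x\<in>A. g x)"
  using assms by (induction rule: finite_induct) (auto intro: pebbling_steps_add_add)

text \<open>Every arc costs a factor of two: each half of the \<open>2 ^ Suc n\<close> pebbles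
  delivers one pebble to the penultimate vertex \<open>w\<close>, and this pair pays for the last
  step to \<open>v\<close>.\<close>

lemma pebbling_steps_relpow:
  "(u, v) \<in> parcs G ^^ n \<Longrightarrow> (pebbling_step G)\<^sup>*\<^sup>* (replicate_mset (2 ^ n) u) {#v#}"
proof (induction n arbitrary: v)
  case 0
  then show ?case by simp
next
  case (Suc n)
  then obtain w where w: "(u, w) \<in> parcs G ^^ n" "(w, v) \<in> parcs G" by auto
  have "(pebbling_step G)\<^sup>*\<^sup>* (replicate_mset (2 ^ n) u + replicate_mset (2 ^ n) u) ({#w#} + {#w#})"
    using Suc.IH[OF w(1)] by (intro pebbling_steps_add_add)
  moreover have "pebbling_step G ({#w#} + {#w#}) {#v#}"
    unfolding pebbling_step_def using w(2) by (intro exI[of _ w] exI[of _ v]) auto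
  moreover have "replicate_mset (2 ^ n) u + replicate_mset (2 ^ n) u = replicate_mset (2 ^ Suc n) u"
    by (simp add: multiset_eq_iff)
  ultimately show ?case by (metis rtranclp.rtrancl_into_rtrancl)
qed

section \<open>Stacks in a connected graph: weights and bounds\<close>

context connected_pair_graph
begin

lemma relpow_gdist:
  assumes "u \<in> pverts G" "v \<in> pverts G"
  shows "(u, v) \<in> parcs G ^^ gdist G u v"
proof -
  obtain n where "(u, v) \<in> parcs G ^^ n"
    using verts_connected[OF assms] rtrancl_imp_relpow by blast
  then show ?thesis
    unfolding gdist_eq_Least_relpow[OF assms(1)] by (rule LeastI)
qed

text \<open>Stacking numbers use distances towards the stack, while its pebbles travel away from it;
  this reverses the walks.\<close>

lemma relpow_commute: "(u, v) \<in> parcs G ^^ n \<Longrightarrow> (v, u) \<in> parcs G ^^ n"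
proof (induction n arbitrary: v)
  case (Suc n)
  then obtain w where "(u, w) \<in> parcs G ^^ n" "(w, v) \<in> parcs G" by auto
  then show ?case using Suc.IH arcs_symmetric relpow_Suc_I2 by metis
qed simp

lemma gdist_arc_le:
  assumes "(u, v) \<in> parcs G" "w \<in> pverts G"
  shows "gdist G v w \<le> Suc (gdist G u w)"
proof (rule gdist_le)
  show "v \<in> pverts G" using assms(1) by (rule in_arcsD2)
  show "(v, w) \<in> parcs G ^^ Suc (gdist G u w)"
    using arcs_symmetric[OF assms(1)] relpow_gdist[OF in_arcsD1[OF assms(1)] assms(2)]
    by (rule relpow_Suc_I2)
qed

text \<open>The two pebbles removed from \<open>x\<close> weigh \<open>2 ^ Suc (gdist G x u)\<close>
  together. The neighbour \<open>y\<close> is at most one step farther from \<open>u\<close>, so the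
  new pebble weighs no more than that.\<close>

lemma pebbling_step_weight_le:
  assumes "pebbling_step G M M'" "u \<in> pverts G"
  shows "(\<Sum>w\<in>#M'. 2 ^ gdist G w u) \<le> (\<Sum>w\<in>#M. 2 ^ gdist G w u :: nat)"
proof -
  obtain x y where xy: "(x, y) \<in> parcs G" "{#x, x#} \<subseteq># M" "M' = M - {#x, x#} + {#y#}"
    using assms(1) unfolding pebbling_step_def by blast
  define K where "K = M - {#x, x#}"
  have M: "M = K + {#x, x#}" "M' = K + {#y#}"
    using xy(2,3) unfolding K_def by (simp_all only: subset_mset.diff_add)
  have "(2::nat) ^ gdist G y u \<le> 2 ^ Suc (gdist G x u)"
    using gdist_arc_le[OF xy(1) assms(2)] by (intro power_increasing) auto
  then show ?thesis by (simp add: M)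
qed

lemma pebbling_steps_weight_le:
  assumes "(pebbling_step G)\<^sup>*\<^sup>* M M'" "u \<in> pverts G"
  shows "(\<Sum>w\<in>#M'. 2 ^ gdist G w u) \<le> (\<Sum>w\<in>#M. 2 ^ gdist G w u :: nat)"
  using assms(1)
  by (induction rule: rtranclp_induct) (auto dest: pebbling_step_weight_le[OF _ assms(2)])

lemma stacking_number_le_of_stack_solvable:
  assumes "cover_solvable G (replicate_mset n u)" "u \<in> pverts G"
  shows "stacking_number G u \<le> n"
proof -
  obtain M where M: "(pebbling_step G)\<^sup>*\<^sup>* (replicate_mset n u) M" "\<And>v. v \<in> pverts G \<Longrightarrow> 1 \<le> count M v"
    using assms(1) unfolding cover_solvable_def by blast
  \<comment> \<open>One pebble per vertex already has total weight
    \<open>stacking_number G u\<close>, so a covering placement weighs at least this much.\<close>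
  have "mset_set (pverts G) \<subseteq># M"
    using M(2) pair_finite_verts by (simp add: subseteq_mset_def count_mset_set')
  then obtain K where "M = mset_set (pverts G) + K"
    by (auto simp: subset_mset.le_iff_add)
  then have "(\<Sum>w\<in>#mset_set (pverts G). 2 ^ gdist G w u) \<le> (\<Sum>w\<in>#M. 2 ^ gdist G w u :: nat)"
    by simp
  also have "\<dots> \<le> (\<Sum>w\<in>#replicate_mset n u. 2 ^ gdist G w u)"
    using pebbling_steps_weight_le[OF M(1) assms(2)] .
  \<comment> \<open>The empty walk gives \<open>gdist G u u = 0\<close>, so each pebble of the stack
    weighs 1.\<close>
  also have "\<dots> = n"
    using gdist_le[OF assms(2), of u 0] by simp
  finally show ?thesis by (simp add: stacking_number_def sum_unfold_sum_mset)
qed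

text \<open>The stack on \<open>u\<close> is split into one block of \<open>2 ^ gdist G w u\<close>
  pebbles for each vertex \<open>w\<close>; each block sends a single pebble to its
  \<open>w\<close>, and the surplus \<open>K\<close> stays in place.\<close>

lemma cover_solvable_if_stack:
  assumes "u \<in> pverts G" "stacking_number G u \<le> count M u"
  shows "cover_solvable G M"
proof -
  define S where "S = (\<Sum>w\<in>pverts G. replicate_mset (2 ^ gdist G w u) u)"
  have "S = replicate_mset (stacking_number G u) u"
    by (simp add: multiset_eq_iff S_def stacking_number_def count_sum)
  then have "S \<subseteq># M"
    using assms(2) by (simp add: count_le_replicate_mset_subset_eq)
  then obtain K where K: "M = S + K"
    by (metis subset_mset.add_diff_inverse)
  have "(pebbling_step G)\<^sup>*\<^sup>* S (\<Sum>w\<in>pverts G. {#w#})"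
    unfolding S_def using assms(1) pair_finite_verts
    by (intro pebbling_steps_sum pebbling_steps_relpow relpow_commute[OF relpow_gdist])
  then have "(pebbling_step G)\<^sup>*\<^sup>* M ((\<Sum>w\<in>pverts G. {#w#}) + K)"
    unfolding K by (rule pebbling_steps_add)
  moreover have "1 \<le> count ((\<Sum>w\<in>pverts G. {#w#}) + K) v" if "v \<in> pverts G" for v
    using that pair_finite_verts by (simp add: count_sum)
  ultimately show ?thesis unfolding cover_solvable_def by blast
qed

text \<open>Ensures that the \<open>LEAST\<close> in \<open>cover_pebbling_number\<close> is
  attained. With as many pebbles as all stacking numbers together, the pigeonhole principle yields a
  vertex \<open>v\<close> holding at least \<open>stacking_number G v\<close> of them.\<close>

lemma ex_cover_solvable_number:
  "\<exists>N. \<forall>M. placement G N M \<longrightarrow> cover_solvable G M"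
proof (intro exI allI impI)
  fix M assume M: "placement G (\<Sum>v\<in>pverts G. stacking_number G v) M"
  show "cover_solvable G M"
  \<comment> \<open>The locale admits the empty graph, where covering is vacuous but the strict
    comparison of sums below would fail.\<close>
  proof (cases "pverts G = {}")
    case True
    then show ?thesis unfolding cover_solvable_def by blast
  next
    case False
    have "\<exists>v\<in>pverts G. stacking_number G v \<le> count M v"
    proof (rule ccontr)
      assume "\<not> ?thesis"
      then have "(\<Sum>v\<in>pverts G. count M v) < (\<Sum>v\<in>pverts G. stacking_number G v)"
        using False pair_finite_verts by (intro sum_strict_mono) auto
      moreover have "size M = (\<Sum>v\<in>pverts G. count M v)"
        using M pair_finite_verts unfolding placement_def size_multiset_overloaded_eq
        by (intro sum.mono_neutral_left) (auto simp: not_in_iff)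
      ultimately show False using M by (simp add: placement_def)
    qed
    then show ?thesis using cover_solvable_if_stack by blast
  qed
qed

lemma stacking_number_le_cover_pebbling_number:
  assumes "u \<in> pverts G"
  shows "stacking_number G u \<le> cover_pebbling_number G"
proof (rule stacking_number_le_of_stack_solvable[OF _ assms])
  have "placement G (cover_pebbling_number G) (replicate_mset (cover_pebbling_number G) u)"
    using assms by (auto simp: placement_def)
  then show "cover_solvable G (replicate_mset (cover_pebbling_number G) u)"
    using LeastI_ex[OF ex_cover_solvable_number] unfolding cover_pebbling_number_def by blast
qed

end

section \<open>Distances and stacking numbers in Cartesian products\<close>

lemma pverts_cartesian_product [simp]:
  "pverts (cartesian_product G H) = pverts G \<times> pverts H"
  by (simp add: cartesian_product_def)

lemma arc_cartesian_product_iff [simp]: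
  "((w, v), (w', v')) \<in> parcs (cartesian_product G H) \<longleftrightarrow>
     w = w' \<and> w \<in> pverts G \<and> (v, v') \<in> parcs H \<or>
     v = v' \<and> v \<in> pverts H \<and> (w, w') \<in> parcs G"
  by (simp add: cartesian_product_def)

text \<open>The walk runs from \<open>(w, v)\<close> to \<open>(a, v)\<close> in the first
  coordinate, then from \<open>(a, v)\<close> to \<open>(a, b)\<close> in the second.\<close>

lemma relpow_cartesian_productI:
  assumes "pair_wf_digraph G"
    and "w \<in> pverts G" "v \<in> pverts H"
    and "(w, a) \<in> parcs G ^^ i" "(v, b) \<in> parcs H ^^ j"
  shows "((w, v), (a, b)) \<in> parcs (cartesian_product G H) ^^ (i + j)"
proof -
  interpret G: pair_wf_digraph G by fact
  \<comment> \<open>The second leg uses arcs that fix \<open>a\<close>, and the product has these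
    only for vertices \<open>a\<close> of \<open>G\<close>.\<close>
  have "a \<in> pverts G"
    using assms(2,4) by (cases i) (auto dest: G.in_arcsD2)
  have "((w, v), (a, v)) \<in> parcs (cartesian_product G H) ^^ i"
    using assms(4)
  proof (induction i arbitrary: a)
    case (Suc i)
    then obtain c where "(w, c) \<in> parcs G ^^ i" "(c, a) \<in> parcs G" by auto
    then show ?case using Suc.IH assms(3) by (intro relpow_Suc_I[of _ "(c, v)"]) auto
  qed simp
  moreover have "((a, v), (a, b)) \<in> parcs (cartesian_product G H) ^^ j"
    using assms(5)
  proof (induction j arbitrary: b)
    case (Suc j)
    then obtain c where "(v, c) \<in> parcs H ^^ j" "(c, b) \<in> parcs H" by auto
    then show ?case using Suc.IH \<open>a \<in> pverts G\<close> by (intro relpow_Suc_I[of _ "(a, c)"]) auto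
  qed simp
  ultimately show ?thesis by (auto simp: relpow_add)
qed

text \<open>Each arc of the product follows an arc of one factor and fixes the other coordinate, so
  it is charged to exactly one of the exponents \<open>i\<close> and \<open>j\<close>.\<close>

lemma relpow_cartesian_productD:
  assumes "((w, v), (a, b)) \<in> parcs (cartesian_product G H) ^^ n"
  shows "\<exists>i j. i + j = n \<and> (w, a) \<in> parcs G ^^ i \<and> (v, b) \<in> parcs H ^^ j"
  using assms
proof (induction n arbitrary: a b)
  case 0
  then show ?case by simp
next
  case (Suc n)
  then obtain c d where cd: "((w, v), (c, d)) \<in> parcs (cartesian_product G H) ^^ n"
      "((c, d), (a, b)) \<in> parcs (cartesian_product G H)"
    by auto
  from Suc.IH[OF cd(1)] obtain i j
    where ij: "i + j = n" "(w, c) \<in> parcs G ^^ i" "(v, d) \<in> parcs H ^^ j" by blast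
  from cd(2) consider "c = a" "(d, b) \<in> parcs H" | "d = b" "(c, a) \<in> parcs G" by auto
  then show ?case
  proof cases
    case 1
    then have "i + Suc j = Suc n" "(w, a) \<in> parcs G ^^ i" "(v, b) \<in> parcs H ^^ Suc j"
      using ij by auto
    then show ?thesis by blast
  next
    case 2
    then have "Suc i + j = Suc n" "(w, a) \<in> parcs G ^^ Suc i" "(v, b) \<in> parcs H ^^ j"
      using ij by auto
    then show ?thesis by blast
  qed
qed

lemma connected_pair_graph_cartesian_product:
  assumes "connected_pair_graph G" "connected_pair_graph H"
  shows "connected_pair_graph (cartesian_product G H)"
proof -
  interpret G: connected_pair_graph G by fact
  interpret H: connected_pair_graph H by fact
  \<comment> \<open>Provides both the well-formedness of the arcs and, through finiteness of the
    vertex sets, the finiteness of the arc set.\<close>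
  have arcs_sub: "parcs (cartesian_product G H)
      \<subseteq> (pverts G \<times> pverts H) \<times> (pverts G \<times> pverts H)"
    by (auto dest: G.in_arcsD1 G.in_arcsD2 H.in_arcsD1 H.in_arcsD2)
  show ?thesis
  proof
    fix e assume "e \<in> parcs (cartesian_product G H)"
    then show "fst e \<in> pverts (cartesian_product G H)" "snd e \<in> pverts (cartesian_product G H)"
      using arcs_sub by auto
  next
    show "finite (pverts (cartesian_product G H))"
      by (simp add: G.pair_finite_verts H.pair_finite_verts)
    show "finite (parcs (cartesian_product G H))"
      by (rule finite_subset[OF arcs_sub]) (simp add: G.pair_finite_verts H.pair_finite_verts)
    show "symmetric (with_proj (cartesian_product G H))"
      by (auto simp: symmetric_def sym_def dest: G.arcs_symmetric H.arcs_symmetric)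
  next
    fix p q assume "p \<in> pverts (cartesian_product G H)" "q \<in> pverts (cartesian_product G H)"
    then obtain w v a b where "p = (w, v)" "q = (a, b)"
        "w \<in> pverts G" "a \<in> pverts G" "v \<in> pverts H" "b \<in> pverts H" by auto
    then show "(p, q) \<in> (parcs (cartesian_product G H))\<^sup>*"
      using relpow_cartesian_productI[OF G.pair_wf_digraph_axioms]
        G.relpow_gdist H.relpow_gdist relpow_imp_rtrancl by metis
  qed
qed

text \<open>A shortest walk in the product projects to walks in the factors whose lengths sum to its
  own; conversely, shortest walks in the factors are concatenated.\<close>

lemma gdist_cartesian_product:
  assumes "connected_pair_graph G" "connected_pair_graph H"
    and "w \<in> pverts G" "a \<in> pverts G" "v \<in> pverts H" "b \<in> pverts H"
  shows "gdist (cartesian_product G H) (w, v) (a, b) = gdist G w a + gdist H v b"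
proof -
  interpret G: connected_pair_graph G by fact
  interpret H: connected_pair_graph H by fact
  interpret P: connected_pair_graph "cartesian_product G H"
    using assms(1,2) by (rule connected_pair_graph_cartesian_product)
  have "((w, v), (a, b)) \<in> parcs (cartesian_product G H) ^^ gdist (cartesian_product G H) (w, v) (a, b)"
    using assms by (intro P.relpow_gdist) auto
  then obtain i j where "i + j = gdist (cartesian_product G H) (w, v) (a, b)"
      "(w, a) \<in> parcs G ^^ i" "(v, b) \<in> parcs H ^^ j"
    using relpow_cartesian_productD by metis
  then have "gdist G w a + gdist H v b \<le> gdist (cartesian_product G H) (w, v) (a, b)"
    using G.gdist_le H.gdist_le assms by (metis add_mono)
  moreover have "gdist (cartesian_product G H) (w, v) (a, b) \<le> gdist G w a + gdist H v b"
    using assms by (intro P.gdist_le relpow_cartesian_productI G.relpow_gdist H.relpow_gdist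
        G.pair_wf_digraph_axioms) auto
  ultimately show ?thesis by simp
qed

text \<open>Powers of two turn the added distances into products, so the double sum factors.\<close>

lemma stacking_number_cartesian_product:
  assumes "connected_pair_graph G" "connected_pair_graph H" "a \<in> pverts G" "b \<in> pverts H"
  shows "stacking_number (cartesian_product G H) (a, b) = stacking_number G a * stacking_number H b"
proof -
  have "stacking_number (cartesian_product G H) (a, b)
      = (\<Sum>(w, v)\<in>pverts G \<times> pverts H. 2 ^ gdist G w a * 2 ^ gdist H v b)"
    unfolding stacking_number_def pverts_cartesian_product
    using assms by (intro sum.cong) (auto simp: gdist_cartesian_product power_add)
  then show ?thesis
    by (simp add: stacking_number_def sum_product sum.cartesian_product)
qed

theorem theorem4p2:
  fixes G :: "'a pair_pre_digraph" and H :: "'b pair_pre_digraph"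
  assumes "pair_graph G" and "Digraph_Component.connected (with_proj G)"
    and "pair_graph H" and "Digraph_Component.connected (with_proj H)"
    and "good G" and "good H"
  shows "cover_pebbling_number (cartesian_product G H)
           = cover_pebbling_number G * cover_pebbling_number H
         \<longleftrightarrow> good (cartesian_product G H)"
proof -
  have G: "connected_pair_graph G" and H: "connected_pair_graph H"
    using assms by (auto intro: connected_pair_graphI)
  note P = connected_pair_graph_cartesian_product[OF G H]
  note le = connected_pair_graph.stacking_number_le_cover_pebbling_number
  obtain a where a: "a \<in> pverts G" "cover_pebbling_number G = stacking_number G a"
    using assms(5) unfolding good_def stacking_number_def by blast
  obtain b where b: "b \<in> pverts H" "cover_pebbling_number H = stacking_number H b"
    using assms(6) unfolding good_def stacking_number_def by blast
  \<comment> \<open>The vertices \<open>a\<close> and \<open>b\<close> witness that the factors are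
    good, so the stack on \<open>(a, b)\<close> realises the product of the two cover pebbling
    numbers.\<close>
  have ab: "stacking_number (cartesian_product G H) (a, b)
      = cover_pebbling_number G * cover_pebbling_number H"
    using stacking_number_cartesian_product[OF G H a(1) b(1)] a b by simp
  show ?thesis
  proof
    assume "cover_pebbling_number (cartesian_product G H)
        = cover_pebbling_number G * cover_pebbling_number H"
    then show "good (cartesian_product G H)"
      unfolding good_def using ab a(1) b(1) by (intro bexI[of _ "(a, b)"]) (auto simp: stacking_number_def)
  next
    assume "good (cartesian_product G H)"
    then obtain c d where cd: "c \<in> pverts G" "d \<in> pverts H"
        "cover_pebbling_number (cartesian_product G H) = stacking_number (cartesian_product G H) (c, d)"
      unfolding good_def stacking_number_def by auto
    \<comment> \<open>The witness \<open>(c, d)\<close> may differ from \<open>(a, b)\<close>, but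
      its stacking number factors, and each factor is bounded by the cover pebbling number of its
      graph.\<close>
    have "cover_pebbling_number (cartesian_product G H)
        \<le> cover_pebbling_number G * cover_pebbling_number H"
      unfolding cd(3) stacking_number_cartesian_product[OF G H cd(1,2)]
      using le[OF G cd(1)] le[OF H cd(2)] by (rule mult_le_mono)
    \<comment> \<open>The reverse inequality comes from stacking all pebbles on
      \<open>(a, b)\<close>.\<close>
    moreover have "cover_pebbling_number G * cover_pebbling_number H
        \<le> cover_pebbling_number (cartesian_product G H)"
      using le[OF P, of "(a, b)"] a(1) b(1) ab by simp
    ultimately show "cover_pebbling_number (cartesian_product G H)
        = cover_pebbling_number G * cover_pebbling_number H"
      by (rule antisym)
  qed
qed

end
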